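(* Let $\alpha<\beta$ be real numbers with $\alpha\beta\neq0$. Put $$A_{\alpha,\beta}=\sup_{f\in\mathcal A}\frac{R_{\alpha,\beta}(\overline f)}{P_{\alpha,\beta}(f)},\qquad C_{\alpha,\beta}=\sup_{\gamma\in\Gamma_{\alpha,\beta}}\frac{R_{\alpha,\beta}(|x|^\gamma)}{P_{\alpha,\beta}(x^\gamma)},$$ $$\overline A_{\alpha,\beta}=\begin{cases}2^{\frac1\alpha} & \text{if } 0<\alpha<\beta,\\ 2^{-\frac1\beta} & \text{if } \alpha<\beta<0,\\ 2^{\frac1\beta-\frac1\alpha} & \text{if } \alpha<0<\beta.\end{cases}$$ Then $A_{\alpha,\beta}\in[C_{\alpha,\beta},\overline A_{\alpha,\beta}]$ and $C_{\alpha,\beta}<\overline A_{\alpha,\beta}$. Moreover, the lower and upper estimates are asymptotically equal, i.e. $C_{\alpha,\beta}/\overline A_{\alpha,\beta}\to1$, in each of the following limits: (i) $\alpha>0$ fixed and $\beta\to+\infty$ (range $0<\alpha<\beta$); (ii) $\beta<0$ fixed and $\alpha\to-\infty$ (range $\alpha<\beta<0$); (iii) $\alpha<0$ fixed and $\beta\to+\infty$ (range $\alpha<0<\beta$); (iv) $\beta>0$ fixed and $\alpha\to-\infty$ (range $\alpha<0<\beta$).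
   Context: $\mathbb R_+=(0,+\infty)$; all intervals $I$ are bounded and of positive length, and $|I|$ is Lebesgue measure. For $\alpha\neq 0$ and a non-negative function $f$ on $I$, $M_{I,\alpha}(f)=\left(\frac1{|I|}\int_I f^\alpha(x)\,dx\right)^{1/\alpha}$. For $\alpha<\beta$, $\alpha\beta\ne0$: for $f$ on $\mathbb R_+$, $P_{\alpha,\beta}(f)=\sup_{I\subset\mathbb R_+}\frac{M_{I,\beta}(f)}{M_{I,\alpha}(f)}$ over all intervals $I\subset\mathbb R_+$; for $g$ on $\mathbb R$, $R_{\alpha,\beta}(g)=\sup_{I\subset\mathbb R}\frac{M_{I,\beta}(g)}{M_{I,\alpha}(g)}$ over all intervals $I\subset\mathbb R$. The even extension of $f$ is $\overline f(x)=f(|x|)$, $x\ne0$ (the value at $0$ is irrelevant); $|x|^\gamma$ is the even extension of the function $x^\gamma$ on $\mathbb R_+$. $\mathcal A$ (for given $\alpha,\beta$) denotes the class of all non-negative measurable functions $f$ on $(0,+\infty)$ for which the means $M_{I,\alpha}(f)$, $M_{I,\beta}(f)$ are finite and positive for every bounded interval $I\subset\mathbb R_+$ (including intervals $(0,b)$) and $P_{\alpha,\beta}(f)<+\infty$ (the Reverse Hölder Inequality). $\Gamma_{\alpha,\beta}=\{\gamma\in\mathbb R:\ \alpha\gamma>-1,\ \beta\gamma>-1\}$. *)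

theory Defs
  imports "HOL-Analysis.Analysis"
begin

(* Powers with values in [0, \<infinity>], used with exponent a \<noteq> 0 only. Real powr has 0 powr a = 0
   also for a < 0, which would make means of negative order ignore the zeros of a function;
   here 0 to a negative power is \<infinity>. *)
definition epow :: "ennreal \<Rightarrow> real \<Rightarrow> ennreal" where
  "epow x a =
    (if x = 0 then (if a < 0 then \<infinity> else 0)
     else if x = \<infinity> then (if a < 0 then 0 else \<infinity>)
     else ennreal (enn2real x powr a))"

definition mean :: "real set \<Rightarrow> real \<Rightarrow> (real \<Rightarrow> real) \<Rightarrow> ennreal" where
  "mean I \<alpha> f =
    epow ((\<integral>\<^sup>+x\<in>I. epow (ennreal (f x)) \<alpha> \<partial>lebesgue) / emeasure lebesgue I) (1 / \<alpha>)"

(* Endpoints may or may not belong to an interval. *)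
definition intervals_in :: "real set \<Rightarrow> real set set" where
  "intervals_in X = {I. is_interval I \<and> bounded I \<and> 0 < emeasure lebesgue I \<and> I \<subseteq> X}"

definition rev_holder :: "real set \<Rightarrow> real \<Rightarrow> real \<Rightarrow> (real \<Rightarrow> real) \<Rightarrow> ennreal" where
  "rev_holder X \<alpha> \<beta> f = (SUP I\<in>intervals_in X. mean I \<beta> f / mean I \<alpha> f)"

abbreviation P_norm :: "real \<Rightarrow> real \<Rightarrow> (real \<Rightarrow> real) \<Rightarrow> ennreal" where
  "P_norm \<equiv> rev_holder {0<..}"

abbreviation R_norm :: "real \<Rightarrow> real \<Rightarrow> (real \<Rightarrow> real) \<Rightarrow> ennreal" where
  "R_norm \<equiv> rev_holder UNIV"

definition even_ext :: "(real \<Rightarrow> real) \<Rightarrow> real \<Rightarrow> real" where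
  "even_ext f x = f \<bar>x\<bar>"

(* Functions on (0, \<infinity>) are represented by total functions; their values outside (0, \<infinity>)
   affect neither membership nor the quantities above. *)
definition RHI_class :: "real \<Rightarrow> real \<Rightarrow> (real \<Rightarrow> real) set" where
  "RHI_class \<alpha> \<beta> = {f.
     (\<forall>x>0. 0 \<le> f x) \<and>
     f \<in> borel_measurable (lebesgue_on {0<..}) \<and>
     (\<forall>I\<in>intervals_in {0<..}.
        0 < mean I \<alpha> f \<and> mean I \<alpha> f < \<infinity> \<and> 0 < mean I \<beta> f \<and> mean I \<beta> f < \<infinity>) \<and>
     P_norm \<alpha> \<beta> f < \<infinity>}"

definition Gamma_set :: "real \<Rightarrow> real \<Rightarrow> real set" where
  "Gamma_set \<alpha> \<beta> = {\<gamma>. \<alpha> * \<gamma> > -1 \<and> \<beta> * \<gamma> > -1}"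

definition A_const :: "real \<Rightarrow> real \<Rightarrow> ennreal" where
  "A_const \<alpha> \<beta> = (SUP f\<in>RHI_class \<alpha> \<beta>. R_norm \<alpha> \<beta> (even_ext f) / P_norm \<alpha> \<beta> f)"

definition C_const :: "real \<Rightarrow> real \<Rightarrow> ennreal" where
  "C_const \<alpha> \<beta> =
    (SUP \<gamma>\<in>Gamma_set \<alpha> \<beta>.
       R_norm \<alpha> \<beta> (even_ext (\<lambda>x. x powr \<gamma>)) / P_norm \<alpha> \<beta> (\<lambda>x. x powr \<gamma>))"

(* Meaningful for \<alpha> < \<beta> with both nonzero; the last branch is then \<alpha> < 0 < \<beta>. *)
definition A_bar :: "real \<Rightarrow> real \<Rightarrow> real" where
  "A_bar \<alpha> \<beta> =
    (if 0 < \<alpha> then 2 powr (1 / \<alpha>)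
     else if \<beta> < 0 then 2 powr (- 1 / \<beta>)
     else 2 powr (1 / \<beta> - 1 / \<alpha>))"

end

(* Split an interval (-a, b) with a \<le> b at 0. Against (0, b), the mean value of the c-th power of the
   even extension changes by a factor E_c between 1/(1 + a/b) and 2/(1 + a/b), so the ratio of
   means changes by E_\<beta> powr (1/\<beta>) / E_\<alpha> powr (1/\<alpha>), which A_bar bounds. For f = x powr \<gamma>,
   E_c = (1 + r powr (1 + c \<gamma>)) / (1 + r) with r = a/b, and E_\<alpha>, E_\<beta> cannot both be extreme; this gives
   a bound below A_bar that is uniform in \<gamma> and r. For \<beta> \<rightarrow> \<infinity> the order \<beta> contributes a factor
   tending to 1, while E_\<alpha> can be brought close to the extreme value that A_bar requires.
   The substitution f \<mapsto> 1/f exchanges (\<alpha>, \<beta>) with (-\<beta>, -\<alpha>) and yields the remaining cases. *)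

theory Submission
  imports Defs "HOL-Real_Asymp.Real_Asymp"
begin

section \<open>Means over intervals and reciprocals\<close>

lemma epow_ennreal: "0 < x \<Longrightarrow> epow (ennreal x) a = ennreal (x powr a)"
  by (simp add: epow_def ennreal_eq_0_iff)

text \<open>Because 0 to a negative power is \<infinity>, the identity holds at 0 and \<infinity> as
  well. For a = 0 it fails: \<open>epow 0 0\<close> is 0, and its inverse is \<infinity>.\<close>

lemma epow_minus: "a \<noteq> 0 \<Longrightarrow> epow x (- a) = inverse (epow x a)"
proof (cases x)
  case (real r)
  assume "a \<noteq> 0"
  then show ?thesis using real
    by (cases "r = 0") (auto simp: epow_def ennreal_eq_0_iff inverse_ennreal powr_minus)
qed (auto simp: epow_def)

lemma ennreal_inverse_inverse: "inverse (inverse x) = (x :: ennreal)"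
proof (cases x)
  case (real r)
  then show ?thesis by (cases "r = 0") (auto simp: inverse_ennreal)
qed auto

lemma borel_measurable_epow [measurable]:
  "(\<lambda>x. epow x a) \<in> borel_measurable borel"
  unfolding epow_def by measurable

lemma epow_pos_finite:
  assumes "0 < epow x a" "epow x a < \<infinity>" "a \<noteq> 0"
  shows "0 < x" "x < \<infinity>"
  using assms by (auto simp: epow_def less_top zero_less_iff_neq_zero split: if_splits)

section \<open>Reduction to open intervals with real endpoints\<close>

definition power_integral :: "real \<Rightarrow> (real \<Rightarrow> real) \<Rightarrow> real \<Rightarrow> real \<Rightarrow> ennreal" where
  "power_integral c f p q = (\<integral>\<^sup>+x\<in>{p<..<q}. epow (ennreal (f x)) c \<partial>lebesgue)"

text \<open>Endpoints are null sets, so open intervals suffice. Working with integrals and lengths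
  instead of means keeps additivity available when an interval is split at 0.\<close>

definition mean_ratio :: "real \<Rightarrow> real \<Rightarrow> (real \<Rightarrow> real) \<Rightarrow> real \<Rightarrow> real \<Rightarrow> ennreal" where
  "mean_ratio \<alpha> \<beta> f p q =
     epow (power_integral \<beta> f p q / ennreal (q - p)) (1 / \<beta>) /
     epow (power_integral \<alpha> f p q / ennreal (q - p)) (1 / \<alpha>)"

lemma AE_lebesgue_neq: "AE x in lebesgue. x \<noteq> (p :: real)"
  by (rule AE_I'[of "{p}"]) auto

text \<open>The endpoints are \<open>Inf I\<close> and \<open>Sup I\<close>. They differ because a
  one-point set is null, and convexity fills the gap between them.\<close>

lemma intervals_in_endpoints:
  assumes "I \<in> intervals_in X"
  obtains p q where "p < q" "{p<..<q} \<subseteq> I" "I \<subseteq> {p..q}"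
proof -
  have I: "is_interval I" "bounded I" "0 < emeasure lebesgue I"
    using assms by (auto simp: intervals_in_def)
  then have ne: "I \<noteq> {}" by auto
  have bd: "bdd_below I" "bdd_above I"
    using I(2) bounded_imp_bdd_above bounded_imp_bdd_below by auto
  have sub: "I \<subseteq> {Inf I..Sup I}"
    using bd by (auto intro: cInf_lower cSup_upper)
  have "Inf I < Sup I"
  proof (rule ccontr)
    assume "\<not> Inf I < Sup I"
    with sub have "I \<subseteq> {Inf I}" by force
    then have "emeasure lebesgue I \<le> emeasure lebesgue {Inf I}"
      by (intro emeasure_mono) auto
    with I(3) show False by simp
  qed
  moreover have "{Inf I<..<Sup I} \<subseteq> I"
  proof
    fix x assume "x \<in> {Inf I<..<Sup I}"
    then obtain y z where "y \<in> I" "y < x" "z \<in> I" "x < z"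
      using cInf_less_iff[OF ne bd(1)] less_cSup_iff[OF ne bd(2)] by auto
    then show "x \<in> I"
      using mem_is_interval_1_I[OF I(1)] less_imp_le by blast
  qed
  ultimately show thesis using sub that by blast
qed

lemma mean_eq_power_integral:
  assumes "p < q" "{p<..<q} \<subseteq> I" "I \<subseteq> {p..q}"
  shows "mean I c f = epow (power_integral c f p q / ennreal (q - p)) (1 / c)"
proof -
  have ae: "AE x in lebesgue. (x \<in> I) = (x \<in> {p<..<q})"
    using AE_lebesgue_neq[of p] AE_lebesgue_neq[of q]
    by eventually_elim (use assms in force)
  have I: "I \<in> sets lebesgue"
  proof -
    have "I = {p<..<q} \<union> (I \<inter> {p, q})" using assms by force
    moreover have "I \<inter> {p, q} \<in> sets lebesgue"
      by (rule sets.countable) (auto intro: countable_finite)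
    moreover have "{p<..<q} \<in> sets lebesgue" by simp
    ultimately show ?thesis by (metis sets.Un)
  qed
  have "emeasure lebesgue I = emeasure lebesgue {p<..<q}"
    using ae I by (intro emeasure_eq_AE) auto
  moreover have "(\<integral>\<^sup>+x\<in>I. epow (ennreal (f x)) c \<partial>lebesgue) = power_integral c f p q"
    unfolding power_integral_def using ae
    by (intro nn_integral_cong_AE) (auto simp: indicator_def elim!: eventually_mono)
  ultimately show ?thesis
    using assms(1) by (simp add: mean_def)
qed

lemma greaterThanLessThan_in_intervals_in:
  "\<lbrakk>p < q; {p<..<q} \<subseteq> X\<rbrakk> \<Longrightarrow> {p<..<q} \<in> intervals_in X"
  by (auto simp: intervals_in_def is_interval_oo)

text \<open>Together with \<open>mean_ratio_le_rev_holder\<close> this turns the supremum over all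
  intervals into one over pairs p < q.\<close>

lemma rev_holder_leI:
  assumes "\<And>p q. \<lbrakk>p < q; {p<..<q} \<subseteq> X\<rbrakk> \<Longrightarrow> mean_ratio \<alpha> \<beta> f p q \<le> K"
  shows "rev_holder X \<alpha> \<beta> f \<le> K"
  unfolding rev_holder_def
proof (rule SUP_least)
  fix I assume I: "I \<in> intervals_in X"
  from intervals_in_endpoints[OF I] obtain p q where pq: "p < q" "{p<..<q} \<subseteq> I" "I \<subseteq> {p..q}" .
  with I have "{p<..<q} \<subseteq> X" by (auto simp: intervals_in_def)
  with assms[OF pq(1)] show "mean I \<beta> f / mean I \<alpha> f \<le> K"
    by (simp add: mean_eq_power_integral[OF pq] mean_ratio_def)
qed

lemma mean_ratio_le_rev_holder:
  assumes "p < q" "{p<..<q} \<subseteq> X"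
  shows "mean_ratio \<alpha> \<beta> f p q \<le> rev_holder X \<alpha> \<beta> f"
proof -
  have "mean_ratio \<alpha> \<beta> f p q = mean {p<..<q} \<beta> f / mean {p<..<q} \<alpha> f"
    using assms(1) by (simp add: mean_ratio_def mean_eq_power_integral greaterThanLessThan_subseteq_atLeastAtMost_iff)
  also have "\<dots> \<le> rev_holder X \<alpha> \<beta> f"
    unfolding rev_holder_def
    by (rule SUP_upper) (rule greaterThanLessThan_in_intervals_in[OF assms])
  finally show ?thesis .
qed

text \<open>The exponents may differ so that f with c can be compared with 1/f with -c. The point 0
  is exempt because \<open>0 powr x\<close> is 0 for every x, which breaks the reciprocal relation
  between even extensions of powers there.\<close>

lemma power_integral_cong:
  assumes "\<And>x. \<lbrakk>p < x; x < q; x \<noteq> 0\<rbrakk> \<Longrightarrow> epow (ennreal (f x)) c = epow (ennreal (g x)) d"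
  shows "power_integral c f p q = power_integral d g p q"
  unfolding power_integral_def
  using AE_lebesgue_neq[of 0]
  by (intro nn_integral_cong_AE) (auto simp: indicator_def assms elim!: eventually_mono)

lemma mean_ratio_cong:
  assumes "\<And>x. \<lbrakk>p < x; x < q; x \<noteq> 0\<rbrakk> \<Longrightarrow> f x = g x"
  shows "mean_ratio \<alpha> \<beta> f p q = mean_ratio \<alpha> \<beta> g p q"
proof -
  have "power_integral c f p q = power_integral c g p q" for c
    by (rule power_integral_cong) (simp add: assms)
  then show ?thesis by (simp add: mean_ratio_def)
qed

section \<open>The substitution of 1/f for f\<close>

lemma mean_ratio_reciprocal:
  assumes "\<alpha> \<noteq> 0" "\<beta> \<noteq> 0"
    and fg: "\<And>x. \<lbrakk>p < x; x < q; x \<noteq> 0\<rbrakk> \<Longrightarrow> 0 < f x \<and> g x = inverse (f x)"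
  shows "mean_ratio (- \<beta>) (- \<alpha>) g p q = mean_ratio \<alpha> \<beta> f p q"
proof -
  have "power_integral (- c) g p q = power_integral c f p q" for c
    using fg by (intro power_integral_cong)
      (auto simp: epow_ennreal powr_minus inverse_powr)
  \<comment> \<open>The integrals agree and the outer exponents change sign, so both means are
    inverted; exchanging the two orders puts numerator and denominator back in place.\<close>
  then show ?thesis using assms(1,2)
    by (simp add: mean_ratio_def epow_minus divide_ennreal_def ennreal_inverse_inverse
        mult.commute[of "inverse (epow _ _)"])
qed

lemma rev_holder_reciprocal:
  assumes "\<alpha> \<noteq> 0" "\<beta> \<noteq> 0" "\<And>x. \<lbrakk>x \<in> X; x \<noteq> 0\<rbrakk> \<Longrightarrow> 0 < f x \<and> g x = inverse (f x)"
  shows "rev_holder X (- \<beta>) (- \<alpha>) g = rev_holder X \<alpha> \<beta> f"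
proof (rule antisym)
  have eq: "mean_ratio (- \<beta>) (- \<alpha>) g p q = mean_ratio \<alpha> \<beta> f p q" if "{p<..<q} \<subseteq> X" for p q
    using that assms by (intro mean_ratio_reciprocal) auto
  show "rev_holder X (- \<beta>) (- \<alpha>) g \<le> rev_holder X \<alpha> \<beta> f"
    by (rule rev_holder_leI) (simp add: eq mean_ratio_le_rev_holder)
  show "rev_holder X \<alpha> \<beta> f \<le> rev_holder X (- \<beta>) (- \<alpha>) g"
    by (rule rev_holder_leI) (simp add: eq[symmetric] mean_ratio_le_rev_holder)
qed

text \<open>The reciprocal of a power is the power with exponent -\<gamma>, so the substitution
  merely reindexes the supremum.\<close>

lemma C_const_reciprocal:
  assumes "\<alpha> \<noteq> 0" "\<beta> \<noteq> 0"
  shows "C_const (- \<beta>) (- \<alpha>) = C_const \<alpha> \<beta>"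
proof -
  have R: "R_norm (- \<beta>) (- \<alpha>) (even_ext (\<lambda>x. x powr - \<gamma>)) = R_norm \<alpha> \<beta> (even_ext (\<lambda>x. x powr \<gamma>))" for \<gamma>
    using assms by (intro rev_holder_reciprocal) (auto simp: even_ext_def powr_minus)
  have P: "P_norm (- \<beta>) (- \<alpha>) (\<lambda>x. x powr - \<gamma>) = P_norm \<alpha> \<beta> (\<lambda>x. x powr \<gamma>)" for \<gamma>
    using assms by (intro rev_holder_reciprocal) (auto simp: powr_minus)
  have "Gamma_set (- \<beta>) (- \<alpha>) = uminus ` Gamma_set \<alpha> \<beta>"
    by (auto simp: Gamma_set_def image_iff intro!: exI[of _ "- _"])
  then show ?thesis
    by (simp add: C_const_def image_comp o_def R P)
qed

text \<open>The exchange swaps the first two branches of \<open>A_bar\<close> and preserves the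
  third.\<close>

lemma A_bar_reciprocal:
  "\<lbrakk>\<alpha> < \<beta>; \<alpha> * \<beta> \<noteq> 0\<rbrakk> \<Longrightarrow> A_bar (- \<beta>) (- \<alpha>) = A_bar \<alpha> \<beta>"
  by (auto simp: A_bar_def)

section \<open>Symmetric extension\<close>

text \<open>Reflection is an affine change of variables whose density factor is 1. It is stated for
  the completed measure because members of the class are only Lebesgue measurable.\<close>

lemma nn_integral_lebesgue_uminus:
  assumes "h \<in> borel_measurable lebesgue"
  shows "(\<lambda>x::real. h (- x)) \<in> borel_measurable lebesgue"
    and "(\<integral>\<^sup>+x. h (- x) \<partial>lebesgue) = (\<integral>\<^sup>+x. h x \<partial>lebesgue)"
proof -
  have m: "uminus \<in> lebesgue \<rightarrow>\<^sub>M (lebesgue :: real measure)"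
    using lebesgue_affine_measurable[of "\<lambda>_. -1" "0::real"] by (simp add: o_def)
  then show "(\<lambda>x::real. h (- x)) \<in> borel_measurable lebesgue"
    using assms by (rule measurable_compose)
  have "density (distr lebesgue lebesgue (\<lambda>x. 0 + - 1 * x)) (\<lambda>_. ennreal \<bar>- 1\<bar>)
      = distr lebesgue lebesgue (uminus :: real \<Rightarrow> real)"
    by (simp add: density_1)
  from trans[OF lebesgue_real_affine this]
  have "(lebesgue :: real measure) = distr lebesgue lebesgue uminus"
    by linarith
  then have "(\<integral>\<^sup>+x. h x \<partial>lebesgue) = (\<integral>\<^sup>+x. h x \<partial>distr lebesgue lebesgue uminus)"
    by (rule arg_cong)
  also have "\<dots> = (\<integral>\<^sup>+x. h (- x) \<partial>lebesgue)"
    by (rule nn_integral_distr[OF m]) (use assms in simp)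
  finally show "(\<integral>\<^sup>+x. h (- x) \<partial>lebesgue) = (\<integral>\<^sup>+x. h x \<partial>lebesgue)"
    by (rule sym)
qed

lemma power_integral_even_ext:
  assumes f: "f \<in> borel_measurable (lebesgue_on {0<..})"
  shows power_integral_even_ext_split:
      "\<lbrakk>0 < a; 0 < b\<rbrakk> \<Longrightarrow>
        power_integral c (even_ext f) (- a) b = power_integral c f 0 a + power_integral c f 0 b"
    and power_integral_even_ext_reflect:
      "q \<le> 0 \<Longrightarrow> power_integral c (even_ext f) p q = power_integral c f (- q) (- p)"
proof -
  \<comment> \<open>f is measurable only on the positive half-line, so the integrand is cut off to
    zero elsewhere; additivity of the integral requires measurability on the whole line.\<close>
  define h where "h A x = (if x \<in> {0<..} then epow (ennreal (f x)) c * indicator A x else 0)" for A and x :: real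
  have h: "h A \<in> borel_measurable lebesgue" if "A \<in> sets lebesgue" for A
  proof -
    define g where "g x = (if x \<in> {0<..} then f x else 0)" for x
    have [measurable]: "g \<in> borel_measurable lebesgue"
      unfolding g_def by (rule borel_measurable_if_I[OF f]) simp
    have [measurable]: "A \<inter> {0<..} \<in> sets lebesgue" using that by (intro sets.Int) auto
    have "(\<lambda>x. epow (ennreal (g x)) c * indicator (A \<inter> {0<..}) x) \<in> borel_measurable lebesgue"
      by measurable
    moreover have "(\<lambda>x. epow (ennreal (g x)) c * indicator (A \<inter> {0<..}) x) = h A"
      by (auto simp: h_def g_def fun_eq_iff indicator_def)
    ultimately show ?thesis by simp
  qed
  have pint: "power_integral c f u v = (\<integral>\<^sup>+x. h {u<..<v} x \<partial>lebesgue)" if "0 \<le> u" for u v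
    unfolding power_integral_def using that
    by (intro nn_integral_cong) (auto simp: h_def indicator_def)
  show "power_integral c (even_ext f) (- a) b = power_integral c f 0 a + power_integral c f 0 b"
    if "0 < a" "0 < b"
  proof -
    have "power_integral c (even_ext f) (- a) b = (\<integral>\<^sup>+x. h {0<..<a} (- x) + h {0<..<b} x \<partial>lebesgue)"
      unfolding power_integral_def using AE_lebesgue_neq[of 0] that
      by (intro nn_integral_cong_AE)
        (auto simp: h_def even_ext_def indicator_def elim!: eventually_mono)
    also have "\<dots> = (\<integral>\<^sup>+x. h {0<..<a} (- x) \<partial>lebesgue) + (\<integral>\<^sup>+x. h {0<..<b} x \<partial>lebesgue)"
      by (intro nn_integral_add nn_integral_lebesgue_uminus(1) h) auto
    also have "\<dots> = power_integral c f 0 a + power_integral c f 0 b"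
      by (simp add: pint nn_integral_lebesgue_uminus(2) h)
    finally show ?thesis .
  qed
  show "power_integral c (even_ext f) p q = power_integral c f (- q) (- p)" if "q \<le> 0"
  proof -
    have "power_integral c (even_ext f) p q = (\<integral>\<^sup>+x. h {- q<..<- p} (- x) \<partial>lebesgue)"
      unfolding power_integral_def using that
      by (intro nn_integral_cong) (auto simp: h_def even_ext_def indicator_def)
    also have "\<dots> = power_integral c f (- q) (- p)"
      using that by (simp add: pint nn_integral_lebesgue_uminus(2) h)
    finally show ?thesis .
  qed
qed

lemma mean_ratio_eq_ennreal:
  assumes "p < q" "power_integral \<alpha> f p q = ennreal A" "power_integral \<beta> f p q = ennreal B" "0 < A" "0 < B"
  shows "mean_ratio \<alpha> \<beta> f p q
    = ennreal ((B / (q - p)) powr (1 / \<beta>) / (A / (q - p)) powr (1 / \<alpha>))"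
  using assms by (simp add: mean_ratio_def divide_ennreal epow_ennreal)

text \<open>Shared by the estimate for the whole class and the one for powers: it reduces the
  comparison of suprema to a real inequality between the factors gained on intervals (-a, b). Here
  \<open>J c b\<close> is the integral of order c over (0, b).\<close>

lemma R_norm_even_ext_le:
  assumes f: "f \<in> borel_measurable (lebesgue_on {0<..})"
    and J: "\<And>c b. \<lbrakk>c \<in> {\<alpha>, \<beta>}; 0 < b\<rbrakk> \<Longrightarrow> power_integral c f 0 b = ennreal (J c b) \<and> 0 < J c b"
    and D: "1 \<le> D"
    and E: "\<And>a b. \<lbrakk>0 < a; a \<le> b\<rbrakk> \<Longrightarrow>
      ((1 + J \<beta> a / J \<beta> b) / (1 + a / b)) powr (1 / \<beta>)
      \<le> D * ((1 + J \<alpha> a / J \<alpha> b) / (1 + a / b)) powr (1 / \<alpha>)"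
  shows "R_norm \<alpha> \<beta> (even_ext f) \<le> ennreal D * P_norm \<alpha> \<beta> f"
proof (rule rev_holder_leI)
  fix p q :: real assume "p < q"
  \<comment> \<open>For intervals on one side of 0 the ratio is already one for f, and 1 \<le> D
    absorbs the constant.\<close>
  have *: "mean_ratio \<alpha> \<beta> (even_ext f) u v \<le> ennreal D * P_norm \<alpha> \<beta> f"
    if "mean_ratio \<alpha> \<beta> (even_ext f) u v \<le> P_norm \<alpha> \<beta> f" for u v
  proof -
    have "1 \<le> ennreal D" using D by simp
    from mult_right_mono[OF this, of "P_norm \<alpha> \<beta> f"] that show ?thesis by simp
  qed
  have large: "mean_ratio \<alpha> \<beta> (even_ext f) (- a) b \<le> ennreal D * P_norm \<alpha> \<beta> f"
    if ab: "0 < a" "a \<le> b" for a b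
  proof -
    let ?E = "\<lambda>c. (1 + J c a / J c b) / (1 + a / b)"
    have pos: "0 < J c a" "0 < J c b" if "c \<in> {\<alpha>, \<beta>}" for c
      using J[OF that] ab by auto
    have Epos: "0 < ?E c" if "c \<in> {\<alpha>, \<beta>}" for c
      using pos[OF that] ab by (intro divide_pos_pos add_pos_pos) auto
    \<comment> \<open>The mean value over (-a, b) is the mean value over (0, b) times the factor
      \<open>?E c\<close>.\<close>
    have eq: "(J c a + J c b) / (b - (- a)) = J c b / b * ?E c" if "c \<in> {\<alpha>, \<beta>}" for c
      using pos[OF that] ab by (simp add: divide_simps)
    have "mean_ratio \<alpha> \<beta> (even_ext f) (- a) b
      = ennreal (((J \<beta> a + J \<beta> b) / (b - (- a))) powr (1 / \<beta>)
          / ((J \<alpha> a + J \<alpha> b) / (b - (- a))) powr (1 / \<alpha>))"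
      using ab J pos
      by (intro mean_ratio_eq_ennreal)
        (auto simp: power_integral_even_ext_split[OF f] ennreal_plus[symmetric] less_imp_le add_pos_pos
          simp del: ennreal_plus)
    also have "\<dots> = ennreal ((J \<beta> b / b * ?E \<beta>) powr (1 / \<beta>) / (J \<alpha> b / b * ?E \<alpha>) powr (1 / \<alpha>))"
      by (simp only: eq insertI1 insertI2)
    also have "\<dots> = ennreal ((?E \<beta> powr (1 / \<beta>) / ?E \<alpha> powr (1 / \<alpha>)) *
         ((J \<beta> b / b) powr (1 / \<beta>) / (J \<alpha> b / b) powr (1 / \<alpha>)))"
      by (simp only: powr_mult) (simp add: mult.commute)
    also have "\<dots> \<le> ennreal (D * ((J \<beta> b / b) powr (1 / \<beta>) / (J \<alpha> b / b) powr (1 / \<alpha>)))"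
      using pos_divide_le_eq[THEN iffD2, OF _ E[OF ab]] Epos[of \<alpha>]
      by (intro ennreal_leI mult_right_mono) (metis insertI1 less_irrefl powr_gt_zero, simp)
    also have "\<dots> = ennreal D * mean_ratio \<alpha> \<beta> f 0 b"
      using ab J D by (subst mean_ratio_eq_ennreal[where A = "J \<alpha> b" and B = "J \<beta> b"])
        (auto simp: ennreal_mult'[symmetric])
    also have "\<dots> \<le> ennreal D * P_norm \<alpha> \<beta> f"
      using ab by (intro mult_left_mono mean_ratio_le_rev_holder) auto
    finally show ?thesis .
  qed
  consider "0 \<le> p" | "q \<le> 0" | "p < 0" "0 < q" "- p \<le> q" | "p < 0" "0 < q" "q \<le> - p"
    by linarith
  then show "mean_ratio \<alpha> \<beta> (even_ext f) p q \<le> ennreal D * P_norm \<alpha> \<beta> f"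
  proof cases
    case 1
    then have "mean_ratio \<alpha> \<beta> (even_ext f) p q = mean_ratio \<alpha> \<beta> f p q"
      by (intro mean_ratio_cong) (auto simp: even_ext_def)
    with 1 \<open>p < q\<close> show ?thesis by (intro *) (auto intro: mean_ratio_le_rev_holder)
  next
    case 2
    then have "mean_ratio \<alpha> \<beta> (even_ext f) p q = mean_ratio \<alpha> \<beta> f (- q) (- p)"
      by (simp add: mean_ratio_def power_integral_even_ext_reflect[OF f] minus_diff_commute)
    with 2 \<open>p < q\<close> show ?thesis by (intro *) (auto intro: mean_ratio_le_rev_holder)
  next
    case 3
    with large[of "- p" q] show ?thesis by simp
  next
    case 4
    \<comment> \<open>Reflecting the interval does not change the integrals, so the longer side may
      be taken on the right.\<close>
    then have "mean_ratio \<alpha> \<beta> (even_ext f) p q = mean_ratio \<alpha> \<beta> (even_ext f) (- q) (- p)"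
      using power_integral_even_ext_split[OF f, of "- p" q] power_integral_even_ext_split[OF f, of q "- p"]
      by (simp add: mean_ratio_def add.commute)
    with large[of q "- p"] 4 show ?thesis by simp
  qed
qed

section \<open>The upper estimate\<close>

lemma divide_le_ennrealI: "x \<le> c * y \<Longrightarrow> y < \<infinity> \<Longrightarrow> x / y \<le> (c :: ennreal)"
proof (cases "y = 0")
  case False
  assume "x \<le> c * y" "y < \<infinity>"
  then have "x / y \<le> c * y / y" by (intro divide_right_mono_ennreal)
  also have "\<dots> = c" using False \<open>y < \<infinity>\<close> by (simp add: ennreal_mult_divide_eq)
  finally show ?thesis .
\<comment> \<open>If y = 0 then x = 0 too, and 0 / 0 is 0 in \<open>ennreal\<close>.\<close>
qed auto

text \<open>Both factors lie between 1/(1 + r) and 2/(1 + r). For 0 < \<alpha> the worst case is the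
  largest \<beta>-factor against the smallest \<alpha>-factor, for \<beta> < 0 the reverse. Since
  2/(1 + r) is at least 1 and 1/\<beta> < 1/\<alpha> there, the exponent 1/\<beta> can be raised to
  1/\<alpha>. For opposite signs both factors are simply bounded by 2.\<close>

lemma A_bar_bound:
  assumes "\<alpha> < \<beta>" "\<alpha> * \<beta> \<noteq> 0" "0 < r" "r \<le> 1" "0 \<le> s" "s \<le> 1" "0 \<le> t" "t \<le> 1"
  shows "((1 + t) / (1 + r)) powr (1 / \<beta>) \<le> A_bar \<alpha> \<beta> * ((1 + s) / (1 + r)) powr (1 / \<alpha>)"
proof -
  let ?E = "\<lambda>x. (1 + x) / (1 + r)"
  have E: "1 / (1 + r) \<le> ?E x" "?E x \<le> 2 / (1 + r)" "0 < ?E x" if "0 \<le> x" "x \<le> 1" for x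
    using that assms(3) by (auto simp: divide_right_mono)
  note Es = E[OF assms(5,6)] and Et = E[OF assms(7,8)]
  have r: "1 \<le> 2 / (1 + r)" "2 / (1 + r) \<le> 2" "0 < 1 / (1 + r)" using assms(3,4) by (auto simp: divide_simps)
  have half: "2 powr x * (1 / (1 + r)) powr x = (2 / (1 + r)) powr x" for x
    using assms(3) by (simp add: powr_mult[symmetric])
  consider "0 < \<alpha>" | "\<beta> < 0" | "\<alpha> < 0" "0 < \<beta>" using assms(1,2) by fastforce
  then show ?thesis
  proof cases
    case 1
    then have "?E t powr (1 / \<beta>) \<le> (2 / (1 + r)) powr (1 / \<beta>)"
      using Et assms(1) by (intro powr_mono2) auto
    also have "\<dots> \<le> (2 / (1 + r)) powr (1 / \<alpha>)"
      using r 1 assms(1) by (intro powr_mono) (auto simp: frac_le)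
    also have "\<dots> = 2 powr (1 / \<alpha>) * (1 / (1 + r)) powr (1 / \<alpha>)" by (simp add: half)
    also have "\<dots> \<le> 2 powr (1 / \<alpha>) * ?E s powr (1 / \<alpha>)"
      using 1 Es r by (intro mult_left_mono powr_mono2) auto
    finally show ?thesis using 1 by (simp add: A_bar_def)
  next
    case 2
    then have "?E t powr (1 / \<beta>) \<le> (1 / (1 + r)) powr (1 / \<beta>)"
      using Et r by (intro powr_mono2') auto
    also have "\<dots> = 2 powr (- 1 / \<beta>) * (2 powr (1 / \<beta>) * (1 / (1 + r)) powr (1 / \<beta>))"
      by (simp add: powr_minus field_simps)
    also have "\<dots> = 2 powr (- 1 / \<beta>) * (2 / (1 + r)) powr (1 / \<beta>)" by (simp only: half)
    also have "\<dots> \<le> 2 powr (- 1 / \<beta>) * (2 / (1 + r)) powr (1 / \<alpha>)"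
      using r 2 assms(1) by (intro mult_left_mono powr_mono) (auto simp: divide_simps)
    also have "\<dots> \<le> 2 powr (- 1 / \<beta>) * ?E s powr (1 / \<alpha>)"
      using 2 Es assms(1) by (intro mult_left_mono powr_mono2') auto
    finally show ?thesis using 2 assms(1) by (simp add: A_bar_def)
  next
    case 3
    then have "?E t powr (1 / \<beta>) \<le> 2 powr (1 / \<beta>)"
      using Et r by (intro powr_mono2) auto
    also have "\<dots> = A_bar \<alpha> \<beta> * 2 powr (1 / \<alpha>)"
      using 3 by (simp add: A_bar_def powr_add[symmetric])
    also have "\<dots> \<le> A_bar \<alpha> \<beta> * ?E s powr (1 / \<alpha>)"
      using 3 Es(3) order.trans[OF Es(2) r(2)]
      by (intro mult_left_mono powr_mono2') (simp_all add: A_bar_def)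
    finally show ?thesis .
  qed
qed

lemma A_bar_ge_1: "\<lbrakk>\<alpha> < \<beta>; \<alpha> * \<beta> \<noteq> 0\<rbrakk> \<Longrightarrow> 1 \<le> A_bar \<alpha> \<beta>"
  by (auto simp: A_bar_def ge_one_powr_ge_zero divide_le_0_iff
      intro!: ge_one_powr_ge_zero order.trans[of "1 / \<alpha>" 0 "1 / \<beta>"])

text \<open>The class controls means over (0, b), and for nonzero c \<open>epow\<close> with
  exponent 1/c is positive and finite only at positive finite arguments.\<close>

lemma RHI_class_power_integral:
  assumes f: "f \<in> RHI_class \<alpha> \<beta>" and c: "c \<in> {\<alpha>, \<beta>}" "c \<noteq> 0" and b: "0 < b"
  obtains x where "power_integral c f 0 b = ennreal x" "0 < x"
proof -
  have "{0<..<b} \<in> intervals_in {0<..}"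
    using b by (intro greaterThanLessThan_in_intervals_in) auto
  with f c have "0 < mean {0<..<b} c f" "mean {0<..<b} c f < \<infinity>"
    by (auto simp: RHI_class_def)
  then have "0 < power_integral c f 0 b / ennreal (b - 0)" "power_integral c f 0 b / ennreal (b - 0) < \<infinity>"
    using b c(2) epow_pos_finite[of "power_integral c f 0 b / ennreal (b - 0)" "1 / c"]
    by (auto simp: mean_eq_power_integral[of 0 b] greaterThanLessThan_subseteq_atLeastAtMost_iff)
  then show thesis
    using that b by (cases "power_integral c f 0 b")
      (auto simp: divide_ennreal ennreal_top_divide ennreal_zero_less_divide zero_less_divide_iff)
qed

lemma A_const_le:
  assumes ab: "\<alpha> < \<beta>" "\<alpha> * \<beta> \<noteq> 0"
  shows "A_const \<alpha> \<beta> \<le> ennreal (A_bar \<alpha> \<beta>)"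
  unfolding A_const_def
proof (rule SUP_least)
  fix f assume f: "f \<in> RHI_class \<alpha> \<beta>"
  define J where "J c b = enn2real (power_integral c f 0 b)" for c b
  have J: "power_integral c f 0 b = ennreal (J c b) \<and> 0 < J c b" if "c \<in> {\<alpha>, \<beta>}" "0 < b" for c b
    using RHI_class_power_integral[OF f that(1) _ that(2)] that(1) ab(2)
    by (metis J_def enn2real_ennreal insert_iff less_imp_le mult_zero_left mult_zero_right singletonD)
  \<comment> \<open>Monotonicity of the integral in the interval is all that
    \<open>A_bar_bound\<close> asks of f.\<close>
  have quot: "0 \<le> J c a / J c b" "J c a / J c b \<le> 1" if "c \<in> {\<alpha>, \<beta>}" "0 < a" "a \<le> b" for a b c
  proof -
    have "power_integral c f 0 a \<le> power_integral c f 0 b"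
      unfolding power_integral_def using that
      by (intro nn_integral_mono) (auto simp: indicator_def)
    then show "0 \<le> J c a / J c b" "J c a / J c b \<le> 1"
      using J[of c a] J[of c b] that by (auto simp: divide_simps)
  qed
  have "R_norm \<alpha> \<beta> (even_ext f) \<le> ennreal (A_bar \<alpha> \<beta>) * P_norm \<alpha> \<beta> f"
    using f J quot ab
    by (intro R_norm_even_ext_le[where J = J] A_bar_bound A_bar_ge_1) (auto simp: RHI_class_def)
  moreover have "P_norm \<alpha> \<beta> f < \<infinity>" using f by (simp add: RHI_class_def)
  ultimately show "R_norm \<alpha> \<beta> (even_ext f) / P_norm \<alpha> \<beta> f \<le> ennreal (A_bar \<alpha> \<beta>)"
    by (rule divide_le_ennrealI)
qed

section \<open>Power functions\<close>

lemma left_endpoint_nonneg: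
  assumes "p < q" "{p<..<q} \<subseteq> {0::real<..}"
  shows "0 \<le> p"
proof (rule ccontr)
  assume "\<not> 0 \<le> p"
  \<comment> \<open>If p < 0, the smaller of 0 and the midpoint is a nonpositive point of the
    interval.\<close>
  then have "min 0 ((p + q) / 2) \<in> {p<..<q}" using assms(1) by (auto simp: min_def)
  with assms(2) have "min 0 ((p + q) / 2) \<in> {0<..}" ..
  then show False by simp
qed

lemma powr_MVT_facts:
  assumes "0 \<le> p" "-1 < d"
  shows continuous_on_powr_shifted: "continuous_on {p..q} (\<lambda>x. x powr (1 + d))"
    and DERIV_powr_shifted: "p < x \<Longrightarrow> ((\<lambda>x. x powr (1 + d)) has_real_derivative (1 + d) * x powr d) (at x)"
proof -
  show "continuous_on {p..q} (\<lambda>x. x powr (1 + d))"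
    using assms by (intro continuous_on_powr' continuous_intros) auto
  show "((\<lambda>x. x powr (1 + d)) has_real_derivative (1 + d) * x powr d) (at x)" if "p < x"
    using assms that has_real_derivative_powr[of x "1 + d"] by simp
qed

text \<open>For p = 0 and negative c \<gamma> the integrand is unbounded near 0. The antiderivative
  is still continuous on the closed interval, so differentiability in the interior is
  enough.\<close>

lemma power_integral_powr:
  assumes pq: "0 \<le> p" "p < q" and d: "-1 < c * \<gamma>"
  shows "power_integral c (\<lambda>x. x powr \<gamma>) p q
    = ennreal ((q powr (1 + c * \<gamma>) - p powr (1 + c * \<gamma>)) / (1 + c * \<gamma>))"
proof -
  let ?d = "c * \<gamma>" and ?F = "\<lambda>x. x powr (1 + c * \<gamma>) / (1 + c * \<gamma>)"
  have "((\<lambda>x. x powr ?d) has_integral ?F q - ?F p) {p..q}"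
  proof (rule fundamental_theorem_of_calculus_interior)
    show "continuous_on {p..q} ?F"
      using continuous_on_powr_shifted[OF pq(1) d] d by (intro continuous_on_divide) auto
    fix x assume "x \<in> {p<..<q}"
    then have "(?F has_real_derivative (1 + ?d) * x powr ?d / (1 + ?d)) (at x)"
      by (intro DERIV_cdivide DERIV_powr_shifted[OF pq(1) d]) auto
    then show "(?F has_vector_derivative x powr ?d) (at x)"
      using d by (simp add: has_real_derivative_iff_has_vector_derivative)
  qed (use pq in auto)
  then have "(\<integral>\<^sup>+x. ennreal (indicator {p..q} x * x powr ?d) \<partial>lborel) = ennreal (?F q - ?F p)"
    by (intro nn_integral_has_integral_lebesgue) auto
  moreover have "power_integral c (\<lambda>x. x powr \<gamma>) p q
      = (\<integral>\<^sup>+x. ennreal (indicator {p..q} x * x powr ?d) \<partial>lebesgue)"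
    unfolding power_integral_def
    using AE_lebesgue_neq[of p] AE_lebesgue_neq[of q]
  proof (intro nn_integral_cong_AE, eventually_elim)
    fix x assume "x \<noteq> p" "x \<noteq> q"
    then show "epow (ennreal (x powr \<gamma>)) c * indicator {p<..<q} x = ennreal (indicator {p..q} x * x powr ?d)"
      using pq by (auto simp: indicator_def epow_ennreal powr_powr mult.commute)
  qed
  ultimately show ?thesis
    by (simp add: nn_integral_completion diff_divide_distrib)
qed

text \<open>\<open>V powr (1 / c)\<close> is the power mean of order c over (p, q). By the mean
  value theorem it equals \<open>z powr \<gamma>\<close> for an interior z, which gives the upper
  bound. The lower bound is its value at p = 0, obtained by comparing
  \<open>p powr (c * \<gamma>)\<close> with \<open>q powr (c * \<gamma>)\<close>.\<close>

lemma power_mean_powr_bounds: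
  fixes p q c \<gamma> :: real
  assumes pq: "0 \<le> p" "p < q" and d: "-1 < c * \<gamma>" and c: "c \<noteq> 0" "0 \<le> \<gamma>"
  defines "V \<equiv> (q powr (1 + c * \<gamma>) - p powr (1 + c * \<gamma>)) / (1 + c * \<gamma>) / (q - p)"
  shows "q powr \<gamma> / (1 + c * \<gamma>) powr (1 / c) \<le> V powr (1 / c)" "V powr (1 / c) \<le> q powr \<gamma>"
proof -
  let ?d = "c * \<gamma>"
  have q: "0 < q" using pq by linarith
  obtain l z where z: "p < z" "z < q"
    "((\<lambda>x. x powr (1 + ?d)) has_real_derivative l) (at z)"
    "q powr (1 + ?d) - p powr (1 + ?d) = (q - p) * l"
    using MVT[OF pq(2) continuous_on_powr_shifted[OF pq(1) d]] DERIV_powr_shifted[OF pq(1) d]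
    by (metis real_differentiable_def)
  have "l = (1 + ?d) * z powr ?d"
    using DERIV_unique z(3) DERIV_powr_shifted[OF pq(1) d z(1)] by blast
  then have V: "V = z powr ?d" using z pq d by (simp add: V_def)
  have z0: "0 < z" using z pq by linarith
  have Veq: "V powr (1 / c) = z powr \<gamma>" using c by (simp add: V powr_powr)
  also have "\<dots> \<le> q powr \<gamma>" using z z0 c by (intro powr_mono2) auto
  finally show "V powr (1 / c) \<le> q powr \<gamma>" .
  have V': "V = (q powr (1 + ?d) - p powr (1 + ?d)) / ((1 + ?d) * (q - p))"
    by (simp add: V_def)
  have p1: "p powr (1 + ?d) = p * p powr ?d" and q1: "q powr (1 + ?d) = q * q powr ?d"
    using pq q by (cases "p = 0"; simp add: powr_add)+
  have eq: "(q powr ?d / (1 + ?d)) powr (1 / c) = q powr \<gamma> / (1 + ?d) powr (1 / c)"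
    using c by (simp add: powr_divide powr_powr)
  have pos: "0 < (1 + ?d) * (q - p)" using pq d by simp
  show "q powr \<gamma> / (1 + c * \<gamma>) powr (1 / c) \<le> V powr (1 / c)"
  proof (cases "0 < c")
    case True
    then have "p powr ?d \<le> q powr ?d" using pq c by (intro powr_mono2) auto
    then have "p * p powr ?d \<le> p * q powr ?d" using pq by (intro mult_left_mono) auto
    then have "q powr ?d / (1 + ?d) \<le> V"
      unfolding V' using pos d pq by (simp add: p1 q1 divide_simps) (simp add: algebra_simps)
    then show ?thesis unfolding eq[symmetric]
      using True d q by (intro powr_mono2) auto
  next
    case False
    then have c: "c < 0" using c by simp
    have "p * q powr ?d \<le> p * p powr ?d"
    proof (cases "p = 0")
      case False
      then show ?thesis
        using pq c assms(5) by (intro mult_left_mono powr_mono2') (auto simp: mult_le_0_iff)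
    qed simp
    then have "V \<le> q powr ?d / (1 + ?d)"
      unfolding V' using pos d pq by (simp add: p1 q1 divide_simps) (simp add: algebra_simps)
    then show ?thesis unfolding eq[symmetric]
      using c z0 by (intro powr_mono2') (auto simp: V)
  qed
qed

lemma powr_diff_pos:
  assumes "0 \<le> p" "p < q" "-1 < c * \<gamma>"
  shows "0 < (q powr (1 + c * \<gamma>) - p powr (1 + c * \<gamma>)) / (1 + c * (\<gamma>::real))"
  using assms by (intro divide_pos_pos) (auto intro!: powr_less_mono2)

text \<open>The mean of order \<beta> is at most \<open>q powr \<gamma>\<close>, and the mean of
  order \<alpha> is at least its value on (0, q); q cancels. The bound is free of \<beta>, which
  suits the limit of large \<beta>.\<close>

lemma P_norm_powr_le:
  assumes "\<alpha> \<noteq> 0" "\<beta> \<noteq> 0" "0 \<le> \<gamma>" "\<gamma> \<in> Gamma_set \<alpha> \<beta>"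
  shows "P_norm \<alpha> \<beta> (\<lambda>x. x powr \<gamma>) \<le> ennreal ((1 + \<alpha> * \<gamma>) powr (1 / \<alpha>))"
proof (rule rev_holder_leI)
  fix p q :: real assume pq: "p < q" "{p<..<q} \<subseteq> {0<..}"
  note p = left_endpoint_nonneg[OF pq]
  have g: "-1 < \<alpha> * \<gamma>" "-1 < \<beta> * \<gamma>" using assms(4) by (auto simp: Gamma_set_def)
  define V where "V c = (q powr (1 + c * \<gamma>) - p powr (1 + c * \<gamma>)) / (1 + c * \<gamma>) / (q - p)" for c
  have q: "0 < q powr \<gamma>" "0 < (1 + \<alpha> * \<gamma>) powr (1 / \<alpha>)" using p pq g by auto
  have "mean_ratio \<alpha> \<beta> (\<lambda>x. x powr \<gamma>) p q = ennreal (V \<beta> powr (1 / \<beta>) / V \<alpha> powr (1 / \<alpha>))"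
    unfolding V_def
    by (intro mean_ratio_eq_ennreal power_integral_powr powr_diff_pos pq p g)
  also have "\<dots> \<le> ennreal (q powr \<gamma> / (q powr \<gamma> / (1 + \<alpha> * \<gamma>) powr (1 / \<alpha>)))"
    unfolding V_def using assms p pq g q
    by (intro ennreal_leI frac_le power_mean_powr_bounds) auto
  also have "\<dots> = ennreal ((1 + \<alpha> * \<gamma>) powr (1 / \<alpha>))"
    using q by simp
  finally show "mean_ratio \<alpha> \<beta> (\<lambda>x. x powr \<gamma>) p q \<le> ennreal ((1 + \<alpha> * \<gamma>) powr (1 / \<alpha>))" .
qed

lemma P_norm_powr_finite:
  assumes "\<alpha> \<noteq> 0" "\<beta> \<noteq> 0" "\<gamma> \<in> Gamma_set \<alpha> \<beta>"
  shows "P_norm \<alpha> \<beta> (\<lambda>x. x powr \<gamma>) < \<infinity>"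
proof (cases "0 \<le> \<gamma>")
  case True
  from le_less_trans[OF P_norm_powr_le[OF assms(1,2) True assms(3)] ennreal_less_top]
  show ?thesis by simp
next
  case False
  \<comment> \<open>Negative exponents reduce to positive ones by the reciprocal.\<close>
  have "P_norm (- \<beta>) (- \<alpha>) (\<lambda>x. x powr - \<gamma>) = P_norm \<alpha> \<beta> (\<lambda>x. x powr \<gamma>)"
    using assms by (intro rev_holder_reciprocal) (auto simp: powr_minus)
  moreover have "P_norm (- \<beta>) (- \<alpha>) (\<lambda>x. x powr - \<gamma>) \<le> ennreal ((1 + - \<beta> * - \<gamma>) powr (1 / - \<beta>))"
    using assms False by (intro P_norm_powr_le) (auto simp: Gamma_set_def)
  ultimately show ?thesis
    using le_less_trans[OF _ ennreal_less_top] by simp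
qed

lemma powr_borel_measurable_lebesgue_on:
  "(\<lambda>x::real. x powr \<gamma>) \<in> borel_measurable (lebesgue_on S)"
  by (intro measurable_restrict_space1 measurable_completion) simp

lemma powr_in_RHI_class:
  assumes "\<alpha> \<noteq> 0" "\<beta> \<noteq> 0" and \<gamma>: "\<gamma> \<in> Gamma_set \<alpha> \<beta>"
  shows "(\<lambda>x. x powr \<gamma>) \<in> RHI_class \<alpha> \<beta>"
proof -
  have "0 < mean I c (\<lambda>x. x powr \<gamma>) \<and> mean I c (\<lambda>x. x powr \<gamma>) < \<infinity>"
    if I: "I \<in> intervals_in {0<..}" and c: "-1 < c * \<gamma>" for I c
  proof -
    from intervals_in_endpoints[OF I] obtain p q
      where pq: "p < q" "{p<..<q} \<subseteq> I" "I \<subseteq> {p..q}" .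
    have p: "0 \<le> p"
      using I pq by (intro left_endpoint_nonneg[OF pq(1)]) (auto simp: intervals_in_def)
    let ?V = "(q powr (1 + c * \<gamma>) - p powr (1 + c * \<gamma>)) / (1 + c * \<gamma>) / (q - p)"
    have V: "0 < ?V" by (rule divide_pos_pos[OF powr_diff_pos[OF p pq(1) c]]) (use pq in simp)
    have "mean I c (\<lambda>x. x powr \<gamma>) = epow (ennreal ?V) (1 / c)"
      unfolding mean_eq_power_integral[OF pq] power_integral_powr[OF p pq(1) c]
      using pq(1) powr_diff_pos[OF p pq(1) c] by (subst divide_ennreal) auto
    then show ?thesis
      unfolding epow_ennreal[OF V]
      by (simp only: ennreal_less_zero_iff powr_gt_zero ennreal_less_top infinity_ennreal_def simp_thms)
        (rule less_imp_neq[OF V, symmetric])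
  qed
  then show ?thesis
    using \<gamma> P_norm_powr_finite[OF assms]
    by (auto simp: RHI_class_def Gamma_set_def powr_borel_measurable_lebesgue_on)
qed

lemma C_const_le_A_const:
  assumes "\<alpha> \<noteq> 0" "\<beta> \<noteq> 0"
  shows "C_const \<alpha> \<beta> \<le> A_const \<alpha> \<beta>"
  unfolding C_const_def A_const_def
  by (rule SUP_least, rule SUP_upper2[OF powr_in_RHI_class[OF assms]]) auto

section \<open>Strictness and asymptotics\<close>

text \<open>The factor \<open>E c\<close> lies in [1/2, 2], equals 1 at c = 0 and decreases in c
  \<gamma>. Hence the sign of \<gamma> decides on which side of 1 each of \<open>E \<alpha>\<close>
  and \<open>E \<beta>\<close> falls, and this excludes the combination of extremes behind
  \<open>A_bar\<close>. The two entries of each maximum come from the two signs of \<gamma>.\<close>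

lemma powr_gain_bound:
  assumes ab: "\<alpha> < \<beta>" "\<alpha> \<noteq> 0" "0 < \<beta>" and r: "0 < r" "r \<le> (1::real)"
    and \<gamma>: "-1 < \<alpha> * \<gamma>" "-1 < \<beta> * \<gamma>"
  defines "D \<equiv> 2 powr (if 0 < \<alpha> then max (1 / \<beta>) (1 / \<alpha> - 1 / \<beta>) else max (- 1 / \<alpha>) (1 / \<beta>))"
  shows "((1 + r powr (1 + \<beta> * \<gamma>)) / (1 + r)) powr (1 / \<beta>)
      \<le> D * ((1 + r powr (1 + \<alpha> * \<gamma>)) / (1 + r)) powr (1 / \<alpha>)"
proof -
  define E where "E c = (1 + r powr (1 + c * \<gamma>)) / (1 + r)" for c
  have D: "2 powr x \<le> D"
    if "x \<le> (if 0 < \<alpha> then max (1 / \<beta>) (1 / \<alpha> - 1 / \<beta>) else max (- 1 / \<alpha>) (1 / \<beta>))" for x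
    unfolding D_def using that by (intro powr_mono) auto
  have E0: "0 < E c" "1 / 2 \<le> E c" for c
    using r powr_ge_zero[of r "1 + c * \<gamma>"] by (auto simp: E_def divide_simps simp del: powr_ge_zero)
  have E2: "E c \<le> 2" if "-1 < c * \<gamma>" for c
  proof -
    have "r powr (1 + c * \<gamma>) \<le> 1" using r that by (intro powr_le1) auto
    then show ?thesis using r by (simp add: E_def divide_simps)
  qed
  have anti: "E d \<le> E c" if "c * \<gamma> \<le> d * \<gamma>" for c d
    unfolding E_def using r that by (intro divide_right_mono add_left_mono powr_mono') auto
  have E1: "E 0 = 1" using r by (simp add: E_def)
  consider "0 < \<alpha>" "0 \<le> \<gamma>" | "0 < \<alpha>" "\<gamma> < 0" | "\<alpha> < 0" "0 \<le> \<gamma>" | "\<alpha> < 0" "\<gamma> < 0"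
    using ab by linarith
  then have "E \<beta> powr (1 / \<beta>) \<le> D * E \<alpha> powr (1 / \<alpha>)"
  proof cases
    case 1
    \<comment> \<open>The \<beta>-factor is first replaced by the \<alpha>-factor; the leftover
      exponent 1/\<beta> - 1/\<alpha> is negative, so the lower bound 1/2 applies.\<close>
    have "E \<beta> powr (1 / \<beta>) \<le> E \<alpha> powr (1 / \<beta>)"
      using 1 ab E0(1)[of \<beta>] by (intro powr_mono2 anti mult_right_mono) auto
    also have "\<dots> = E \<alpha> powr (1 / \<beta> - 1 / \<alpha>) * E \<alpha> powr (1 / \<alpha>)"
      by (simp add: powr_add[symmetric])
    also have "\<dots> \<le> (1 / 2) powr (1 / \<beta> - 1 / \<alpha>) * E \<alpha> powr (1 / \<alpha>)"
      using 1 ab E0 by (intro mult_right_mono powr_mono2') (auto simp: frac_le)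
    also have "(1 / 2) powr (1 / \<beta> - 1 / \<alpha>) = 2 powr (1 / \<alpha> - 1 / \<beta>)"
      by (simp add: powr_divide powr_minus_divide[symmetric])
    finally show ?thesis
      using 1 mult_right_mono[OF D[of "1 / \<alpha> - 1 / \<beta>"], of "E \<alpha> powr (1 / \<alpha>)"] by simp
  next
    case 2
    have "E \<beta> powr (1 / \<beta>) \<le> 2 powr (1 / \<beta>) * 1"
      using ab E0(1)[of \<beta>] E2[OF \<gamma>(2)] by (simp add: powr_mono2)
    also have "\<dots> \<le> D * E \<alpha> powr (1 / \<alpha>)"
      using 2 anti[of \<alpha> 0] E1
      by (intro mult_mono D ge_one_powr_ge_zero) (auto simp: mult_nonneg_nonpos D_def)
    finally show ?thesis .
  next
    case 3
    \<comment> \<open>Here the \<beta>-factor gains nothing and only \<open>E \<alpha>\<close>, at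
      most 2, contributes.\<close>
    have "E \<beta> powr (1 / \<beta>) \<le> 1"
      using ab 3 anti[of 0 \<beta>] E1 E0(1)[of \<beta>] by (intro powr_le1) auto
    also have "1 = 2 powr (- 1 / \<alpha>) * 2 powr (1 / \<alpha>)"
      by (simp add: powr_add[symmetric])
    also have "\<dots> \<le> D * E \<alpha> powr (1 / \<alpha>)"
      using 3 E0(1)[of \<alpha>] E2[OF \<gamma>(1)]
      by (intro mult_mono D powr_mono2') (auto simp: D_def)
    finally show ?thesis .
  next
    case 4
    have "E \<beta> powr (1 / \<beta>) \<le> 2 powr (1 / \<beta>) * 1"
      using ab E0(1)[of \<beta>] E2[OF \<gamma>(2)] by (simp add: powr_mono2)
    also have "\<dots> \<le> D * E \<alpha> powr (1 / \<alpha>)"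
    proof (intro mult_mono D)
      have "1 powr (1 / \<alpha>) \<le> E \<alpha> powr (1 / \<alpha>)"
        using 4 anti[of 0 \<alpha>] E1 E0(1)[of \<alpha>] by (intro powr_mono2') (auto simp: mult_nonpos_nonpos)
      then show "1 \<le> E \<alpha> powr (1 / \<alpha>)" by simp
    qed (use 4 in \<open>auto simp: D_def\<close>)
    finally show ?thesis .
  qed
  then show ?thesis by (simp add: E_def)
qed

lemma C_const_le_powr_gain:
  assumes ab: "\<alpha> < \<beta>" "\<alpha> \<noteq> 0" "0 < \<beta>"
  shows "C_const \<alpha> \<beta> \<le> ennreal (2 powr (if 0 < \<alpha> then max (1 / \<beta>) (1 / \<alpha> - 1 / \<beta>) else max (- 1 / \<alpha>) (1 / \<beta>)))"
  unfolding C_const_def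
proof (rule SUP_least)
  fix \<gamma> assume "\<gamma> \<in> Gamma_set \<alpha> \<beta>"
  then have \<gamma>: "-1 < \<alpha> * \<gamma>" "-1 < \<beta> * \<gamma>" by (auto simp: Gamma_set_def)
  let ?D = "2 powr (if 0 < \<alpha> then max (1 / \<beta>) (1 / \<alpha> - 1 / \<beta>) else max (- 1 / \<alpha>) (1 / \<beta>))"
  define J where "J c b = b powr (1 + c * \<gamma>) / (1 + c * \<gamma>)" for c b
  have "R_norm \<alpha> \<beta> (even_ext (\<lambda>x. x powr \<gamma>)) \<le> ennreal ?D * P_norm \<alpha> \<beta> (\<lambda>x. x powr \<gamma>)"
  proof (rule R_norm_even_ext_le[where J = J])
    show "power_integral c (\<lambda>x. x powr \<gamma>) 0 b = ennreal (J c b) \<and> 0 < J c b"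
      if "c \<in> {\<alpha>, \<beta>}" "0 < b" for c b
      using that \<gamma> power_integral_powr[of 0 b c \<gamma>] by (auto simp: J_def)
    show "1 \<le> ?D"
      using ab by (intro ge_one_powr_ge_zero) (auto simp: le_max_iff_disj)
    show "((1 + J \<beta> a / J \<beta> b) / (1 + a / b)) powr (1 / \<beta>)
        \<le> ?D * ((1 + J \<alpha> a / J \<alpha> b) / (1 + a / b)) powr (1 / \<alpha>)"
      if "0 < a" "a \<le> b" for a b
    proof -
      \<comment> \<open>Powers are homogeneous, so only the ratio r = a/b matters.\<close>
      have "J c a / J c b = (a / b) powr (1 + c * \<gamma>)" if "-1 < c * \<gamma>" for c
        using that by (simp add: J_def powr_divide)
      with powr_gain_bound[OF ab _ _ \<gamma>, of "a / b"] \<gamma> that show ?thesis by simp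
    qed
  qed (rule powr_borel_measurable_lebesgue_on)
  moreover have "P_norm \<alpha> \<beta> (\<lambda>x. x powr \<gamma>) < \<infinity>"
    using P_norm_powr_finite ab \<open>\<gamma> \<in> Gamma_set \<alpha> \<beta>\<close> by auto
  ultimately show "R_norm \<alpha> \<beta> (even_ext (\<lambda>x. x powr \<gamma>)) / P_norm \<alpha> \<beta> (\<lambda>x. x powr \<gamma>) \<le> ennreal ?D"
    by (rule divide_le_ennrealI)
qed

lemma C_const_less_A_bar:
  assumes ab: "\<alpha> < \<beta>" "\<alpha> * \<beta> \<noteq> 0"
  shows "C_const \<alpha> \<beta> < ennreal (A_bar \<alpha> \<beta>)"
proof -
  have pos: "C_const a b < ennreal (A_bar a b)" if "a < b" "a \<noteq> 0" "0 < b" for a b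
  proof -
    \<comment> \<open>Strictness survives the supremum because this bound is uniform in \<gamma>:
      each entry of the maximum is strictly below the exponent in \<open>A_bar\<close>.\<close>
    have "2 powr (if 0 < a then max (1 / b) (1 / a - 1 / b) else max (- 1 / a) (1 / b)) < A_bar a b"
      using that by (auto simp: A_bar_def intro!: powr_less_mono frac_less2)
    then show ?thesis
      by (intro le_less_trans[OF C_const_le_powr_gain[OF that]]) (simp add: ennreal_less_iff)
  qed
  show ?thesis
  proof (cases "0 < \<beta>")
    case True
    with ab show ?thesis by (intro pos) auto
  next
    case False
    with ab have "C_const (- \<beta>) (- \<alpha>) < ennreal (A_bar (- \<beta>) (- \<alpha>))" by (intro pos) auto
    with ab show ?thesis by (simp add: C_const_reciprocal A_bar_reciprocal)
  qed
qed

text \<open>On (-r, 1) the supremum of the powers is 1, as it is on (0, 1), so the crude bound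
  P_norm_powr_le for the denominator loses nothing in the limit of large \<beta>.\<close>

lemma C_const_ge:
  assumes ab: "\<alpha> \<noteq> 0" "0 < \<beta>" and \<gamma>: "0 < \<gamma>" "-1 < \<alpha> * \<gamma>" and r: "0 < r" "r < 1"
  shows "ennreal ((1 / (2 * (1 + \<beta> * \<gamma>))) powr (1 / \<beta>)
      * ((1 + r) / (1 + r powr (1 + \<alpha> * \<gamma>))) powr (1 / \<alpha>)) \<le> C_const \<alpha> \<beta>"
proof -
  let ?f = "\<lambda>x::real. x powr \<gamma>"
  let ?X = "(1 / (2 * (1 + \<beta> * \<gamma>))) powr (1 / \<beta>)"
  define K where "K = (1 + r) / (1 + r powr (1 + \<alpha> * \<gamma>))"
  have K: "0 < K" using r by (auto simp: K_def intro!: divide_pos_pos add_pos_nonneg)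
  have \<beta>\<gamma>: "0 < \<beta> * \<gamma>" using ab \<gamma> by simp
  have mem: "\<gamma> \<in> Gamma_set \<alpha> \<beta>" using \<gamma> \<beta>\<gamma> by (simp add: Gamma_set_def)
  define S where "S c = (1 + r powr (1 + c * \<gamma>)) / (1 + c * \<gamma>)" for c
  have S0: "0 < S c" if "-1 < c * \<gamma>" for c
    unfolding S_def using that powr_ge_zero[of r "1 + c * \<gamma>"] by (intro divide_pos_pos) linarith+
  have S: "power_integral c (even_ext ?f) (- r) 1 = ennreal (S c)" if "-1 < c * \<gamma>" for c
  proof -
    have "power_integral c (even_ext ?f) (- r) 1
        = ennreal (r powr (1 + c * \<gamma>) / (1 + c * \<gamma>)) + ennreal (1 / (1 + c * \<gamma>))"
      using r that power_integral_powr[of 0 r c \<gamma>] power_integral_powr[of 0 1 c \<gamma>]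
      by (subst power_integral_even_ext_split) (auto intro: powr_borel_measurable_lebesgue_on)
    also have "\<dots> = ennreal (S c)"
      using that by (subst ennreal_plus[symmetric]) (auto simp: S_def add_divide_distrib add.commute)
    finally show ?thesis .
  qed
  have P: "P_norm \<alpha> \<beta> ?f \<le> ennreal ((1 + \<alpha> * \<gamma>) powr (1 / \<alpha>))"
    using ab \<gamma> mem by (intro P_norm_powr_le) auto
  \<comment> \<open>The claim is proved in multiplied form; dividing by \<open>P_norm\<close>
    afterwards requires it to be finite and nonzero. The interval (-r, 1) alone suffices as a test
    interval.\<close>
  have "ennreal (?X * K powr (1 / \<alpha>)) * P_norm \<alpha> \<beta> ?f
      \<le> ennreal (?X * K powr (1 / \<alpha>)) * ennreal ((1 + \<alpha> * \<gamma>) powr (1 / \<alpha>))"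
    by (intro mult_left_mono P) auto
  also have "\<dots> = ennreal (?X * (K * (1 + \<alpha> * \<gamma>)) powr (1 / \<alpha>))"
    by (simp add: ennreal_mult'[symmetric] powr_mult)
  also have "\<dots> \<le> ennreal ((S \<beta> / (1 - (- r))) powr (1 / \<beta>) * (K * (1 + \<alpha> * \<gamma>)) powr (1 / \<alpha>))"
  proof (intro ennreal_leI mult_right_mono powr_mono2)
    \<comment> \<open>For order \<beta> the contribution of (-r, 0) is discarded and r < 1 is used;
      this loses only a factor 2, which the exponent 1/\<beta> makes harmless.\<close>
    have "1 / 2 \<le> (1 + u) / (1 + r)" if "0 \<le> u" for u using r that by (simp add: divide_simps)
    from divide_right_mono[OF this[OF powr_ge_zero], of "1 + \<beta> * \<gamma>"]
    show "1 / (2 * (1 + \<beta> * \<gamma>)) \<le> S \<beta> / (1 - (- r))"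
      using \<beta>\<gamma> by (simp add: S_def mult.commute)
  qed (use ab \<beta>\<gamma> in auto)
  also have "(K * (1 + \<alpha> * \<gamma>)) powr (1 / \<alpha>) = 1 / (S \<alpha> / (1 - (- r))) powr (1 / \<alpha>)"
  proof -
    \<comment> \<open>The bound for \<open>P_norm\<close> cancels the denominator of
      \<open>S \<alpha>\<close> exactly, so nothing is lost in order \<alpha>.\<close>
    have "K * (1 + \<alpha> * \<gamma>) = inverse (S \<alpha> / (1 - (- r)))"
      by (simp add: K_def S_def divide_simps)
    then show ?thesis by (simp add: powr_divide)
  qed
  also have "ennreal ((S \<beta> / (1 - (- r))) powr (1 / \<beta>) * (1 / (S \<alpha> / (1 - (- r))) powr (1 / \<alpha>)))
      = mean_ratio \<alpha> \<beta> (even_ext ?f) (- r) 1"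
    using r \<gamma> \<beta>\<gamma> by (subst mean_ratio_eq_ennreal[OF _ S S]) (auto intro: S0)
  also have "\<dots> \<le> R_norm \<alpha> \<beta> (even_ext ?f)"
    using r by (intro mean_ratio_le_rev_holder) auto
  finally have main: "ennreal (?X * K powr (1 / \<alpha>)) * P_norm \<alpha> \<beta> ?f \<le> R_norm \<alpha> \<beta> (even_ext ?f)" .
  have Pfin: "P_norm \<alpha> \<beta> ?f < \<infinity>" using P_norm_powr_finite ab mem by auto
  have Ppos: "P_norm \<alpha> \<beta> ?f \<noteq> 0"
  proof -
    have "mean_ratio \<alpha> \<beta> ?f 0 1
        = ennreal ((1 / (1 + \<beta> * \<gamma>) / (1 - 0)) powr (1 / \<beta>) / (1 / (1 + \<alpha> * \<gamma>) / (1 - 0)) powr (1 / \<alpha>))"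
      using power_integral_powr[of 0 1 \<alpha> \<gamma>] power_integral_powr[of 0 1 \<beta> \<gamma>] \<gamma> \<beta>\<gamma>
      by (intro mean_ratio_eq_ennreal) auto
    also have "\<dots> > 0" using \<gamma> \<beta>\<gamma> by simp
    finally have "0 < mean_ratio \<alpha> \<beta> ?f 0 1" .
    also have "\<dots> \<le> P_norm \<alpha> \<beta> ?f" by (intro mean_ratio_le_rev_holder) auto
    finally show ?thesis by simp
  qed
  have "ennreal (?X * K powr (1 / \<alpha>)) = ennreal (?X * K powr (1 / \<alpha>)) * P_norm \<alpha> \<beta> ?f / P_norm \<alpha> \<beta> ?f"
    using Ppos Pfin by (simp add: ennreal_mult_divide_eq)
  also have "\<dots> \<le> R_norm \<alpha> \<beta> (even_ext ?f) / P_norm \<alpha> \<beta> ?f"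
    by (intro divide_right_mono_ennreal main)
  also have "\<dots> \<le> C_const \<alpha> \<beta>"
    unfolding C_const_def by (rule SUP_upper[OF mem])
  finally show ?thesis by (simp add: K_def)
qed

text \<open>For positive \<alpha> take r near 1 and then \<gamma> large; for negative \<alpha> take r near 0 and then
  \<alpha> \<gamma> near -1.\<close>

lemma powr_gain_attained:
  fixes \<alpha> y :: real
  assumes \<alpha>: "\<alpha> \<noteq> 0" and y: "0 < y" "y < 2 powr (1 / \<bar>\<alpha>\<bar>)"
  obtains \<gamma> r where "0 < \<gamma>" "-1 < \<alpha> * \<gamma>" "0 < r" "r < 1"
    "y < ((1 + r) / (1 + r powr (1 + \<alpha> * \<gamma>))) powr (1 / \<alpha>)"
proof -
  \<comment> \<open>Removing the outer exponent turns the hypothesis on y into z < 2.\<close>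
  define z where "z = y powr \<bar>\<alpha>\<bar>"
  have z: "0 < z" "z < 2" "y = z powr (1 / \<bar>\<alpha>\<bar>)"
  proof -
    have "z < (2 powr (1 / \<bar>\<alpha>\<bar>)) powr \<bar>\<alpha>\<bar>"
      unfolding z_def using y \<alpha> by (intro powr_less_mono2) auto
    then show "z < 2" using \<alpha> by (simp add: powr_powr)
  qed (use y \<alpha> in \<open>auto simp: z_def powr_powr\<close>)
  show thesis
  proof (cases "0 < \<alpha>")
    case True
    \<comment> \<open>The choice r > z - 1 makes the limit 1 + r for d \<rightarrow> \<infinity>
      exceed z. Here d stands for 1 + \<alpha> \<gamma>, which is solved for \<gamma> below.\<close>
    obtain r where r: "max 0 (z - 1) < r" "r < 1" using z dense[of "max 0 (z - 1)" 1] by auto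
    have "((\<lambda>d. (1 + r) / (1 + r powr d)) \<longlongrightarrow> (1 + r) / (1 + 0)) at_top"
      using r by (intro tendsto_intros) (real_asymp, auto)
    then have "eventually (\<lambda>d. z < (1 + r) / (1 + r powr d)) at_top"
      by (rule order_tendstoD) (use r in auto)
    then obtain d where d: "1 < d" "z < (1 + r) / (1 + r powr d)"
      using eventually_happens[OF eventually_conj[OF eventually_gt_at_top[of 1]]]
      by (metis trivial_limit_at_top_linorder)
    show thesis
    proof (rule that[of "(d - 1) / \<alpha>" r])
      show "y < ((1 + r) / (1 + r powr (1 + \<alpha> * ((d - 1) / \<alpha>)))) powr (1 / \<alpha>)"
        using True d z by (auto intro: powr_less_mono2)
    qed (use True d r in auto)
  next
    case False
    then have neg: "\<alpha> < 0" using \<alpha> by simp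
    have "1 < 2 / z" using z by simp
    \<comment> \<open>The choice r < 2/z - 1 means z < 2/(1 + r), the limit for d tending to 0 from
      the right. Now 0 < d < 1 makes \<gamma> = (d - 1)/\<alpha> positive.\<close>
    then obtain r where r: "0 < r" "r < min 1 (2 / z - 1)" using dense[of 0 "min 1 (2 / z - 1)"] by auto
    have "((\<lambda>d. (1 + r powr d) / (1 + r)) \<longlongrightarrow> (1 + r powr 0) / (1 + r)) (at_right 0)"
      using r by (intro tendsto_intros) auto
    then have "eventually (\<lambda>d. z < (1 + r powr d) / (1 + r)) (at_right 0)"
      by (rule order_tendstoD) (use r z in \<open>auto simp: field_simps\<close>)
    moreover have "eventually (\<lambda>d. d \<in> {0<..<1}) (at_right (0::real))"
      by (rule eventually_at_right_real) simp
    ultimately have "eventually (\<lambda>d. z < (1 + r powr d) / (1 + r) \<and> d \<in> {0<..<1}) (at_right 0)"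
      by (rule eventually_conj)
    then obtain d where d: "0 < d" "d < 1" "z < (1 + r powr d) / (1 + r)"
      using eventually_happens'[of "at_right (0::real)"] trivial_limit_at_right_real[of 0] by auto
    show thesis
    proof (rule that[of "(d - 1) / \<alpha>" r])
      have "y < ((1 + r powr d) / (1 + r)) powr (1 / - \<alpha>)"
        using neg d(3) z by (auto intro: powr_less_mono2)
      also have "\<dots> = ((1 + r) / (1 + r powr d)) powr (1 / \<alpha>)"
        by (simp add: powr_minus inverse_powr[symmetric])
      finally show "y < ((1 + r) / (1 + r powr (1 + \<alpha> * ((d - 1) / \<alpha>)))) powr (1 / \<alpha>)"
        using neg by simp
    qed (use neg d r in \<open>auto simp: divide_neg_neg\<close>)
  qed
qed

section \<open>The limits\<close>

lemma C_const_A_bar_at_top: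
  assumes \<alpha>: "\<alpha> \<noteq> 0"
  shows "((\<lambda>\<beta>. C_const \<alpha> \<beta> / ennreal (A_bar \<alpha> \<beta>)) \<longlongrightarrow> 1) at_top"
proof (rule order_tendstoI)
  fix a :: ennreal assume a: "1 < a"
  have "eventually (\<lambda>\<beta>. max 0 \<alpha> < \<beta>) at_top" by (rule eventually_gt_at_top)
  then show "eventually (\<lambda>\<beta>. C_const \<alpha> \<beta> / ennreal (A_bar \<alpha> \<beta>) < a) at_top"
  proof eventually_elim
    case (elim \<beta>)
    then have "C_const \<alpha> \<beta> < ennreal (A_bar \<alpha> \<beta>)"
      using \<alpha> by (intro C_const_less_A_bar) auto
    then have "C_const \<alpha> \<beta> / ennreal (A_bar \<alpha> \<beta>) \<le> 1"
      by (intro divide_le_ennrealI) auto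
    with a show ?case by simp
  qed
next
  fix a :: ennreal assume a: "a < 1"
  define w where "w = enn2real a"
  have w: "a = ennreal w" "0 \<le> w" "w < 1"
    using a by (cases a; auto simp: w_def ennreal_less_one_iff)+
  \<comment> \<open>L is the limit of \<open>A_bar \<alpha> \<beta>\<close> for both signs of
    \<alpha>.\<close>
  define L where "L = 2 powr (1 / \<bar>\<alpha>\<bar>)"
  \<comment> \<open>The midpoint of w and 1 leaves room on both sides: y < L and w < y/L. The
    parameters \<gamma> and r obtained from y are fixed before \<beta> grows.\<close>
  define y where "y = (w + 1) / 2 * L"
  have L: "0 < L" by (simp add: L_def)
  have "0 < y" "y < L" using w L by (auto simp: y_def)
  then obtain \<gamma> r where \<gamma>: "0 < \<gamma>" "-1 < \<alpha> * \<gamma>" and r: "0 < r" "r < 1"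
    and y: "y < ((1 + r) / (1 + r powr (1 + \<alpha> * \<gamma>))) powr (1 / \<alpha>)"
    using powr_gain_attained[OF \<alpha>] unfolding L_def by metis
  define G where "G = ((1 + r) / (1 + r powr (1 + \<alpha> * \<gamma>))) powr (1 / \<alpha>)"
  have "((\<lambda>\<beta>. (1 / (2 * (1 + \<beta> * \<gamma>))) powr (1 / \<beta>)) \<longlongrightarrow> 1) at_top"
    using \<gamma>(1) by real_asymp
  moreover have "(A_bar \<alpha> \<longlongrightarrow> L) at_top"
  proof (cases "0 < \<alpha>")
    case True
    then have "A_bar \<alpha> = (\<lambda>_. L)" by (auto simp: fun_eq_iff A_bar_def L_def)
    then show ?thesis by simp
  next
    case False
    then have "\<alpha> < 0" using \<alpha> by simp
    have "((\<lambda>\<beta>. 2 powr (1 / \<beta> - 1 / \<alpha>)) \<longlongrightarrow> 2 powr (0 - 1 / \<alpha>)) at_top"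
      by (intro tendsto_intros) (real_asymp, auto)
    moreover have "eventually (\<lambda>\<beta>. 2 powr (1 / \<beta> - 1 / \<alpha>) = A_bar \<alpha> \<beta>) at_top"
      using eventually_gt_at_top[of 0]
      by eventually_elim (use \<open>\<alpha> < 0\<close> in \<open>auto simp: A_bar_def\<close>)
    ultimately show ?thesis
      using \<open>\<alpha> < 0\<close> by (auto simp: L_def intro: Lim_transform_eventually)
  qed
  ultimately have "((\<lambda>\<beta>. (1 / (2 * (1 + \<beta> * \<gamma>))) powr (1 / \<beta>) * G / A_bar \<alpha> \<beta>) \<longlongrightarrow> 1 * G / L) at_top"
    using L by (intro tendsto_intros) auto
  moreover have "w < 1 * G / L"
  proof -
    have "w \<le> (w + 1) / 2" using w by simp
    also have "\<dots> = y / L" using L by (simp add: y_def)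
    also have "\<dots> < G / L" using y L by (simp add: G_def divide_strict_right_mono)
    finally show ?thesis by simp
  qed
  ultimately have "eventually (\<lambda>\<beta>. w < (1 / (2 * (1 + \<beta> * \<gamma>))) powr (1 / \<beta>) * G / A_bar \<alpha> \<beta>) at_top"
    by (rule order_tendstoD)
  then show "eventually (\<lambda>\<beta>. a < C_const \<alpha> \<beta> / ennreal (A_bar \<alpha> \<beta>)) at_top"
    using eventually_gt_at_top[of 0]
  proof eventually_elim
    case (elim \<beta>)
    have A: "0 < A_bar \<alpha> \<beta>" by (simp add: A_bar_def)
    have "a < ennreal ((1 / (2 * (1 + \<beta> * \<gamma>))) powr (1 / \<beta>) * G / A_bar \<alpha> \<beta>)"
      using elim w by (simp add: ennreal_less_iff)
    also have "\<dots> = ennreal ((1 / (2 * (1 + \<beta> * \<gamma>))) powr (1 / \<beta>) * G) / ennreal (A_bar \<alpha> \<beta>)"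
      using A by (intro divide_ennreal[symmetric]) (auto simp: G_def)
    also have "\<dots> \<le> C_const \<alpha> \<beta> / ennreal (A_bar \<alpha> \<beta>)"
      unfolding G_def using elim \<alpha> \<gamma> r by (intro divide_right_mono_ennreal C_const_ge) auto
    finally show ?case .
  qed
qed

lemma C_const_A_bar_at_bot:
  assumes \<beta>: "\<beta> \<noteq> 0"
  shows "((\<lambda>\<alpha>. C_const \<alpha> \<beta> / ennreal (A_bar \<alpha> \<beta>)) \<longlongrightarrow> 1) at_bot"
proof (rule Lim_transform_eventually)
  show "((\<lambda>\<alpha>. C_const (- \<beta>) (- \<alpha>) / ennreal (A_bar (- \<beta>) (- \<alpha>))) \<longlongrightarrow> 1) at_bot"
    using \<beta> by (intro filterlim_compose[OF C_const_A_bar_at_top filterlim_uminus_at_top_at_bot]) auto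
  \<comment> \<open>Eventually \<alpha> is negative and below \<beta>, as
    \<open>A_bar_reciprocal\<close> requires.\<close>
  have "eventually (\<lambda>\<alpha>. \<alpha> < min 0 \<beta>) at_bot" by (rule eventually_gt_at_bot)
  then show "eventually (\<lambda>\<alpha>. C_const (- \<beta>) (- \<alpha>) / ennreal (A_bar (- \<beta>) (- \<alpha>))
      = C_const \<alpha> \<beta> / ennreal (A_bar \<alpha> \<beta>)) at_bot"
    by eventually_elim (use \<beta> in \<open>auto simp: C_const_reciprocal A_bar_reciprocal\<close>)
qed

text \<open>The ranges in (i) to (iv) are implicit in the filters: \<alpha> < \<beta> and the sign
  of the moving parameter hold eventually.\<close>

theorem mainTheorem3:
  shows "(\<forall>\<alpha> \<beta> :: real. \<alpha> < \<beta> \<and> \<alpha> * \<beta> \<noteq> 0 \<longrightarrow>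
            A_const \<alpha> \<beta> \<in> {C_const \<alpha> \<beta> .. ennreal (A_bar \<alpha> \<beta>)} \<and>
            C_const \<alpha> \<beta> < ennreal (A_bar \<alpha> \<beta>)) \<and>
         (\<forall>\<alpha>>0. ((\<lambda>\<beta>. C_const \<alpha> \<beta> / ennreal (A_bar \<alpha> \<beta>)) \<longlongrightarrow> 1) at_top) \<and>
         (\<forall>\<beta><0. ((\<lambda>\<alpha>. C_const \<alpha> \<beta> / ennreal (A_bar \<alpha> \<beta>)) \<longlongrightarrow> 1) at_bot) \<and>
         (\<forall>\<alpha><0. ((\<lambda>\<beta>. C_const \<alpha> \<beta> / ennreal (A_bar \<alpha> \<beta>)) \<longlongrightarrow> 1) at_top) \<and>
         (\<forall>\<beta>>0. ((\<lambda>\<alpha>. C_const \<alpha> \<beta> / ennreal (A_bar \<alpha> \<beta>)) \<longlongrightarrow> 1) at_bot)"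
  by (auto intro: C_const_A_bar_at_top C_const_A_bar_at_bot C_const_less_A_bar
      C_const_le_A_const A_const_le)

end
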